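(* Let $a,b$ be real numbers. The solutions of the second-order difference equation $$u_{n+2}=\frac{a\,u_n}{1+b\,u_nu_{n+1}}$$ are given, in terms of the initial values $u_0,u_1$, by $$u_n=\exp\left[(-1)^{n-1}\ln|u_1|+(-1)^{n-1}\sum_{k=1}^{n-1}(-1)^{-k}\ln\left|\frac{u_0u_1a^{k}}{1+b\,u_0u_1\left(\sum_{i=0}^{k-1}a^i\right)}\right|\right],$$ with $$-\frac{1}{b\,u_0u_1}\notin\left\{1,\;1+a,\;\dots,\;\sum_{i=0}^{n-2}a^{i}\right\}.$$
   Context: Here $(u_n)$ is the sequence determined by the initial values $u_0,u_1$ and the recursion, and $\ln$ is the natural logarithm.
   Formalization: The right side is always positive, so the formula fails when u_n<0 (e.g. u_0=u_1=-1, n=1); it is proved for |u_n|, hence for u_n whenever u_n>0, with n≥1 and a, u_0, u_1 nonzero so that the logarithms are defined; for b=0 no exclusion condition is imposed. *)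

theory Defs
  imports Complex_Main
begin

definition is_solution :: "real \<Rightarrow> real \<Rightarrow> (nat \<Rightarrow> real) \<Rightarrow> bool" where
  "is_solution a b u \<longleftrightarrow> (\<forall>n. u (n + 2) = a * u n / (1 + b * u n * u (n + 1)))"

(* Intended for n >= 1 only, where the truncated subtraction n - 1 is genuine. *)
definition closed_form :: "real \<Rightarrow> real \<Rightarrow> real \<Rightarrow> real \<Rightarrow> nat \<Rightarrow> real" where
  "closed_form a b u0 u1 n =
     exp ((-1) ^ (n - 1) * ln \<bar>u1\<bar> +
          (-1) ^ (n - 1) *
            (\<Sum>k = 1..n - 1. (-1) powi (- int k) *
               ln \<bar>(u0 * u1 * a ^ k) / (1 + b * u0 * u1 * (\<Sum>i = 0..k - 1. a ^ i))\<bar>))"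

(* The set {1, 1 + a, ..., 1 + a + ... + a^(n-2)}, empty for n < 2.  If -1/(b u0 u1) lies
   outside it, no denominator vanishes in the steps of the recursion producing u 2, ..., u n. *)
definition forbidden_values :: "real \<Rightarrow> nat \<Rightarrow> real set" where
  "forbidden_values a n = {\<Sum>i = 0..j. a ^ i | j. j + 2 \<le> n}"

end

(* The products v k = u k * u (k+1) satisfy v (k+1) = a * v k / (1 + b * v k), a Moebius recursion
   whose solution is v k = v 0 * a^k / (1 + b * v 0 * (1 + a + ... + a^(k-1))).  Then
   \<bar>u (k+1)\<bar> = \<bar>v k\<bar> / \<bar>u k\<bar>, and unwinding this gives the alternating sum of logarithms. *)
theory Submission
  imports Defs
begin

lemma product_closed_form:
  fixes u :: "nat \<Rightarrow> real"
  assumes sol: "is_solution a b u"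
    and denom: "\<And>j. j < m \<Longrightarrow> 1 + b * u 0 * u 1 * (\<Sum>i = 0..j. a ^ i) \<noteq> 0"
  shows "u m * u (Suc m) = u 0 * u 1 * a ^ m / (1 + b * u 0 * u 1 * (\<Sum>i<m. a ^ i))"
  using denom
proof (induction m)
  case 0
  then show ?case by simp
next
  case (Suc m)
  define c where "c = b * u 0 * u 1"
  \<comment> \<open>The sum runs over \<open>i<k\<close> so that \<open>D 0 = 1\<close>; under
    truncated subtraction, the range \<open>0..k - 1\<close> would give \<open>1 + c\<close>
    there.\<close>
  define D where "D k = 1 + c * (\<Sum>i<k. a ^ i)" for k
  have nz: "D k \<noteq> 0" if "k \<le> Suc m" for k
  proof (cases k)
    case 0
    then show ?thesis by (simp add: D_def)
  next
    case (Suc j)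
    then show ?thesis
      using Suc.prems[of j] that by (simp add: D_def c_def lessThan_Suc_atMost atMost_atLeast0)
  qed
  have D_Suc: "D (Suc m) = D m + c * a ^ m"
    by (simp add: D_def algebra_simps)
  have IH: "u m * u (Suc m) = u 0 * u 1 * a ^ m / D m"
    using Suc by (simp add: D_def c_def)
  \<comment> \<open>The denominator of the recursion is a ratio of consecutive \<open>D\<close>'s,
    so \<open>D m\<close> cancels against the denominator in \<open>IH\<close>.\<close>
  have "1 + b * u m * u (Suc m) = 1 + b * (u m * u (Suc m))" by simp
  also have "\<dots> = D (Suc m) / D m"
    unfolding IH D_Suc using nz[of m] by (simp add: c_def field_simps)
  finally have den: "1 + b * u m * u (Suc m) = D (Suc m) / D m" .
  have "u (Suc m) * u (Suc (Suc m)) = a * (u m * u (Suc m)) / (1 + b * u m * u (Suc m))"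
    using sol by (simp add: is_solution_def)
  also have "\<dots> = u 0 * u 1 * a ^ Suc m / D (Suc m)"
    unfolding den IH using nz[of m] nz[of "Suc m"] by (simp add: field_simps)
  finally show ?case by (simp add: D_def c_def)
qed

text \<open>Raising the index by one flips the sign of the whole exponent and adds one summand,
  whose two signs cancel. So the new exponent is the logarithm of the new term minus the old
  exponent. The assumptions make that term positive, so that \<open>exp\<close> undoes
  \<open>ln\<close>.\<close>

lemma closed_form_Suc_Suc:
  assumes "a \<noteq> 0" "u0 \<noteq> 0" "u1 \<noteq> 0" "1 + b * u0 * u1 * (\<Sum>i = 0..m. a ^ i) \<noteq> 0"
  shows "closed_form a b u0 u1 (Suc (Suc m)) =
    \<bar>u0 * u1 * a ^ Suc m / (1 + b * u0 * u1 * (\<Sum>i = 0..m. a ^ i))\<bar> / closed_form a b u0 u1 (Suc m)"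
proof -
  let ?v = "\<bar>u0 * u1 * a ^ Suc m / (1 + b * u0 * u1 * (\<Sum>i = 0..m. a ^ i))\<bar>"
  define E where "E = (\<Sum>k = 1..m. (-1) powi (- int k) *
    ln \<bar>(u0 * u1 * a ^ k) / (1 + b * u0 * u1 * (\<Sum>i = 0..k - 1. a ^ i))\<bar>)"
  have pos: "?v > 0" using assms by simp
  \<comment> \<open>Since -1 is its own inverse, the negative integer exponent becomes a natural
    one.\<close>
  have sign: "(-1::real) powi (- int (Suc m)) = (-1) ^ Suc m"
    by (simp only: power_int_minus power_int_of_nat flip: power_inverse) simp
  have split: "(\<Sum>k = 1..Suc m. (-1) powi (- int k) *
      ln \<bar>(u0 * u1 * a ^ k) / (1 + b * u0 * u1 * (\<Sum>i = 0..k - 1. a ^ i))\<bar>)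
    = E + (-1) ^ Suc m * ln ?v"
    unfolding E_def sign[symmetric] by (subst sum.nat_ivl_Suc') (simp_all del: power_Suc of_nat_Suc)
  have "closed_form a b u0 u1 (Suc (Suc m)) =
      exp ((-1) ^ Suc m * ln \<bar>u1\<bar> + (-1) ^ Suc m * (E + (-1) ^ Suc m * ln ?v))"
    unfolding closed_form_def diff_Suc_1 split ..
  also have "(-1) ^ Suc m * ln \<bar>u1\<bar> + (-1) ^ Suc m * (E + (-1) ^ Suc m * ln ?v)
      = ln ?v - ((-1) ^ m * ln \<bar>u1\<bar> + (-1) ^ m * E)"
  proof -
    have "(-1) ^ Suc m * ((-1) ^ Suc m * x) = x" for x :: real
      by (simp flip: mult.assoc power_add mult_2)
    then show ?thesis by (simp only: distrib_left) simp
  qed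
  also have "exp \<dots> = ?v / exp ((-1) ^ m * ln \<bar>u1\<bar> + (-1) ^ m * E)"
    using pos by (simp only: exp_diff exp_ln)
  finally show ?thesis by (simp add: closed_form_def E_def)
qed

text \<open>Both sides start at \<open>\<bar>u 1\<bar>\<close> and obey the same recursion: the next
  value is \<open>\<bar>v (Suc m)\<bar>\<close> divided by the current one.\<close>

lemma abs_solution_eq_closed_form:
  fixes u :: "nat \<Rightarrow> real"
  assumes sol: "is_solution a b u" and nz: "a \<noteq> 0" "u 0 \<noteq> 0" "u 1 \<noteq> 0"
    and denom: "\<And>j. j < m \<Longrightarrow> 1 + b * u 0 * u 1 * (\<Sum>i = 0..j. a ^ i) \<noteq> 0"
  shows "\<bar>u (Suc m)\<bar> = closed_form a b (u 0) (u 1) (Suc m)"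
  using denom
proof (induction m)
  case 0
  then show ?case using nz by (simp add: closed_form_def)
next
  case (Suc m)
  have IH: "\<bar>u (Suc m)\<bar> = closed_form a b (u 0) (u 1) (Suc m)"
    using Suc by simp
  \<comment> \<open>An exponential never vanishes, so the division by
    \<open>\<bar>u (Suc m)\<bar>\<close> below is genuine.\<close>
  then have "u (Suc m) \<noteq> 0"
    by (auto simp: closed_form_def)
  have v: "u (Suc m) * u (Suc (Suc m))
      = u 0 * u 1 * a ^ Suc m / (1 + b * u 0 * u 1 * (\<Sum>i = 0..m. a ^ i))"
    using product_closed_form[OF sol, of "Suc m", OF Suc.prems]
    by (simp only: lessThan_Suc_atMost atMost_atLeast0)
  have "closed_form a b (u 0) (u 1) (Suc (Suc m)) =
      \<bar>u 0 * u 1 * a ^ Suc m / (1 + b * u 0 * u 1 * (\<Sum>i = 0..m. a ^ i))\<bar>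
        / closed_form a b (u 0) (u 1) (Suc m)"
    by (rule closed_form_Suc_Suc[OF nz Suc.prems]) simp
  also have "\<dots> = \<bar>u (Suc m) * u (Suc (Suc m))\<bar> / \<bar>u (Suc m)\<bar>"
    unfolding v IH ..
  also have "\<dots> = \<bar>u (Suc (Suc m))\<bar>"
    using \<open>u (Suc m) \<noteq> 0\<close> by (simp add: abs_mult)
  finally show ?case ..
qed

text \<open>An exponential is positive, so it can only give \<open>u n\<close> up to sign. The guard
  on \<open>nondeg\<close> is there because for \<open>b = 0\<close> the quotient is 0 by
  convention, and 0 may be a forbidden value (\<open>a = -1\<close>, \<open>n \<ge> 3\<close>)
  although every denominator is 1.\<close>

theorem mainTheorem1:
  fixes a b :: real and u :: "nat \<Rightarrow> real" and n :: nat
  assumes sol: "is_solution a b u"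
    and a_nz: "a \<noteq> 0"
    and u0_nz: "u 0 \<noteq> 0"
    and u1_nz: "u 1 \<noteq> 0"
    and n_pos: "n \<ge> 1"
    and nondeg: "b \<noteq> 0 \<Longrightarrow> - 1 / (b * u 0 * u 1) \<notin> forbidden_values a n"
  shows "\<bar>u n\<bar> = closed_form a b (u 0) (u 1) n
    \<and> (u n > 0 \<longrightarrow> u n = closed_form a b (u 0) (u 1) n)"
proof -
  obtain m where n: "n = Suc m"
    using n_pos by (cases n) auto
  have "1 + b * u 0 * u 1 * (\<Sum>i = 0..j. a ^ i) \<noteq> 0" if "j < m" for j
  proof
    assume eq: "1 + b * u 0 * u 1 * (\<Sum>i = 0..j. a ^ i) = 0"
    then have "b \<noteq> 0" by auto
    then have "b * u 0 * u 1 \<noteq> 0"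
      using u0_nz u1_nz by simp
    moreover have "- 1 = (\<Sum>i = 0..j. a ^ i) * (b * u 0 * u 1)"
      using eq by (simp add: algebra_simps)
    ultimately have "- 1 / (b * u 0 * u 1) = (\<Sum>i = 0..j. a ^ i)"
      by (simp only: divide_eq_eq) simp
    \<comment> \<open>With \<open>n = Suc m\<close>, the bound \<open>j + 2 \<le> n\<close> is
      exactly \<open>j < m\<close>.\<close>
    moreover have "(\<Sum>i = 0..j. a ^ i) \<in> forbidden_values a n"
      using that n by (auto simp: forbidden_values_def)
    ultimately show False
      using nondeg[OF \<open>b \<noteq> 0\<close>] by simp
  qed
  then have "\<bar>u n\<bar> = closed_form a b (u 0) (u 1) n"
    unfolding n by (rule abs_solution_eq_closed_form[OF sol a_nz u0_nz u1_nz])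
  then show ?thesis by auto
qed

end
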